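(* Let $C\subseteq\{N,R,L,Fa,Fu\}$. Then $\{\Gamma_i\Rightarrow\Delta_i\}_{i\in I}\vdash_{\mathbf{STL}(C,D)}\Gamma\Rightarrow\Delta$ iff $\{\Gamma_i\Rightarrow\Delta_i\}_{i\in I}\vDash_{\mathbf{K}(C)}\Gamma\Rightarrow\Delta$. The same holds with $\mathbf{STL}(C,D)$ replaced by $\mathbf{STL}(C,H)$ (over the language with $\supset$).
   Context: \textbf{Calculus.} Language $\{\wedge,\vee,\to,\top,\bot,\nabla\}$, plus $\supset$ for the $H$ version. Sequents are $\Gamma\Rightarrow\Delta$ with finite multisets and $|\Delta|\le1$; $\nabla\Gamma=\{\nabla\gamma\mid\gamma\in\Gamma\}$. $\mathbf{STL}$ rules (premises / conclusion): - Axioms: $A\Rightarrow A$; $\bot\Rightarrow$; $\Rightarrow\top$. - Weakening: $\Gamma\Rightarrow\Delta$ / $\Gamma,A\Rightarrow\Delta$; $\Gamma\Rightarrow$ / $\Gamma\Rightarrow A$. - Contraction: $\Gamma,A,A\Rightarrow\Delta$ / $\Gamma,A\Rightarrow\Delta$. - Cut: $\Gamma\Rightarrow A$, $\Pi,A\Rightarrow\Delta$ / $\Pi,\Gamma\Rightarrow\Delta$. - Conjunction: left rules for either conjunct; $\Gamma\Rightarrow A$, $\Gamma\Rightarrow B$ / $\Gamma\Rightarrow A\wedge B$. - Disjunction: $A\Rightarrow\Delta$, $B\Rightarrow\Delta$ / $A\vee B\Rightarrow\Delta$; right rules for either disjunct. - Modality: $A\Rightarrow B$ / $\nabla A\Rightarrow\nabla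 B$. - Left implication: $\Gamma\Rightarrow A$, $\Gamma,B\Rightarrow\Delta$ / $\Gamma,\nabla(A\to B)\Rightarrow\Delta$. - Right implication: $\nabla\Gamma,A\Rightarrow B$ / $\Gamma\Rightarrow A\to B$. Additional rules: - (R): $\Gamma\Rightarrow A$ / $\Gamma\Rightarrow\nabla A$. - (L): $\Gamma,A\Rightarrow\Delta$ / $\Gamma,\nabla A\Rightarrow\Delta$. - (D): $\Gamma,A\Rightarrow\Delta$, $\Gamma,B\Rightarrow\Delta$ / $\Gamma,A\vee B\Rightarrow\Delta$. - (N): $\Gamma\Rightarrow\Delta$ / $\nabla\Gamma\Rightarrow\nabla\Delta$. - (Fa): $\Gamma,A\Rightarrow B$ / $\Gamma\Rightarrow\nabla(A\to B)$. - (Fu): $\nabla\Gamma\Rightarrow A$, $\nabla\Gamma,B\Rightarrow\nabla\Delta$ / $\Gamma,A\to B\Rightarrow\Delta$. - (H): $\Gamma\Rightarrow A$, $\Gamma,B\Rightarrow\Delta$ / $\Gamma,A\supset B\Rightarrow\Delta$; $\Gamma,A\Rightarrow B$ / $\Gamma\Rightarrow A\supset B$. \textbf{Kripke frames.} A Kripke frame $(W,\le,R)$ is a poset with $R\subseteq W^2$ such that $k'\le k$, $(k,l)\in R$, $l\le l'$ imply $(k',l')\in R$. Conditions: - N: there is an order-preserving $\pi$ with $(x,y)\in R$ iff $x\le\pi(y)$. - R: $\le\,\subseteq R$. - L: $R\subseteq\,\le$. - Fa: for all $x$ there is $y$ with $(y,x)\in R$ such that $(y,z)\in R$ implies $x\le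 z$. - Fu: for all $x$ there is $y$ with $(x,y)\in R$ such that $(z,y)\in R$ implies $z\le x$. $\mathbf{K}(C)$ is the class of Kripke frames satisfying $C$. \textbf{Kripke models.} A model adds $V$ mapping atoms to upsets. Forcing is as usual for atoms, $\wedge,\vee,\top,\bot$, and: - $w\Vdash\nabla A$ iff $\exists u$ with $(u,w)\in R$ and $u\Vdash A$; - $w\Vdash A\to B$ iff for all $u$ with $(w,u)\in R$, $u\Vdash A$ implies $u\Vdash B$; - $w\Vdash A\supset B$ iff for all $u\ge w$, $u\Vdash A$ implies $u\Vdash B$. A model validates $\Gamma\Rightarrow\Delta$ if at every $w$, forcing all of $\Gamma$ implies forcing some member of $\Delta$. $\mathcal{S}\vDash_{\mathbf{K}(C)}S$ means every model on a frame in $\mathbf{K}(C)$ validating $\mathcal{S}$ validates $S$. *)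

theory Defs
  imports "HOL-Library.Multiset"
begin

datatype 'a fm =
    Atom 'a
  | Top
  | Bot
  | And "'a fm" "'a fm"
  | Or "'a fm" "'a fm"
  | Nabla "'a fm"
  | Imp "'a fm" "'a fm"
  | HImp "'a fm" "'a fm" \<comment> \<open>the additional implication \<open>\<supset>\<close>\<close>

text \<open>The at most one formula on the right of a sequent is an option.\<close>

datatype 'a sequent = Seq "'a fm multiset" "'a fm option"  (infix \<open>\<Rrightarrow>\<close> 45)

datatype rule = rN | rR | rL | rFa | rFu | rD | rH

text \<open>
  Both languages live in one datatype: \<open>HImp\<close> belongs to the language of a calculus exactly
  when that calculus has the rules (H).
\<close>

primrec himp_free :: "'a fm \<Rightarrow> bool" where
  "himp_free (Atom p) \<longleftrightarrow> True"
| "himp_free Top \<longleftrightarrow> True"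
| "himp_free Bot \<longleftrightarrow> True"
| "himp_free (And A B) \<longleftrightarrow> himp_free A \<and> himp_free B"
| "himp_free (Or A B) \<longleftrightarrow> himp_free A \<and> himp_free B"
| "himp_free (Nabla A) \<longleftrightarrow> himp_free A"
| "himp_free (Imp A B) \<longleftrightarrow> himp_free A \<and> himp_free B"
| "himp_free (HImp A B) \<longleftrightarrow> False"

definition language :: "rule set \<Rightarrow> 'a fm set" where
  "language X = {A. rH \<in> X \<or> himp_free A}"

definition sequents :: "rule set \<Rightarrow> 'a sequent set" where
  "sequents X = {\<Gamma> \<Rrightarrow> \<Delta> | \<Gamma> \<Delta>. set_mset \<Gamma> \<subseteq> language X \<and> set_option \<Delta> \<subseteq> language X}"

abbreviation Nablas :: "'a fm multiset \<Rightarrow> 'a fm multiset" where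
  "Nablas \<Gamma> \<equiv> image_mset Nabla \<Gamma>"

inductive inference :: "rule set \<Rightarrow> 'a sequent list \<Rightarrow> 'a sequent \<Rightarrow> bool" for X where
  ax_id: "inference X [] ({#A#} \<Rrightarrow> Some A)"
| ax_bot: "inference X [] ({#Bot#} \<Rrightarrow> None)"
| ax_top: "inference X [] ({#} \<Rrightarrow> Some Top)"
| weak_left: "inference X [\<Gamma> \<Rrightarrow> \<Delta>] (add_mset A \<Gamma> \<Rrightarrow> \<Delta>)"
| weak_right: "inference X [\<Gamma> \<Rrightarrow> None] (\<Gamma> \<Rrightarrow> Some A)"
| contr: "inference X [add_mset A (add_mset A \<Gamma>) \<Rrightarrow> \<Delta>] (add_mset A \<Gamma> \<Rrightarrow> \<Delta>)"
| cut: "inference X [\<Gamma> \<Rrightarrow> Some A, add_mset A \<Pi> \<Rrightarrow> \<Delta>] (\<Pi> + \<Gamma> \<Rrightarrow> \<Delta>)"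
| and_left1: "inference X [add_mset A \<Gamma> \<Rrightarrow> \<Delta>] (add_mset (And A B) \<Gamma> \<Rrightarrow> \<Delta>)"
| and_left2: "inference X [add_mset B \<Gamma> \<Rrightarrow> \<Delta>] (add_mset (And A B) \<Gamma> \<Rrightarrow> \<Delta>)"
| and_right: "inference X [\<Gamma> \<Rrightarrow> Some A, \<Gamma> \<Rrightarrow> Some B] (\<Gamma> \<Rrightarrow> Some (And A B))"
| or_left: "inference X [{#A#} \<Rrightarrow> \<Delta>, {#B#} \<Rrightarrow> \<Delta>] ({#Or A B#} \<Rrightarrow> \<Delta>)"
| or_right1: "inference X [\<Gamma> \<Rrightarrow> Some A] (\<Gamma> \<Rrightarrow> Some (Or A B))"
| or_right2: "inference X [\<Gamma> \<Rrightarrow> Some B] (\<Gamma> \<Rrightarrow> Some (Or A B))"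
| nabla: "inference X [{#A#} \<Rrightarrow> Some B] ({#Nabla A#} \<Rrightarrow> Some (Nabla B))"
| imp_left:
    "inference X [\<Gamma> \<Rrightarrow> Some A, add_mset B \<Gamma> \<Rrightarrow> \<Delta>] (add_mset (Nabla (Imp A B)) \<Gamma> \<Rrightarrow> \<Delta>)"
| imp_right: "inference X [add_mset A (Nablas \<Gamma>) \<Rrightarrow> Some B] (\<Gamma> \<Rrightarrow> Some (Imp A B))"
| rule_R: "rR \<in> X \<Longrightarrow> inference X [\<Gamma> \<Rrightarrow> Some A] (\<Gamma> \<Rrightarrow> Some (Nabla A))"
| rule_L: "rL \<in> X \<Longrightarrow> inference X [add_mset A \<Gamma> \<Rrightarrow> \<Delta>] (add_mset (Nabla A) \<Gamma> \<Rrightarrow> \<Delta>)"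
| rule_D: "rD \<in> X \<Longrightarrow>
    inference X [add_mset A \<Gamma> \<Rrightarrow> \<Delta>, add_mset B \<Gamma> \<Rrightarrow> \<Delta>] (add_mset (Or A B) \<Gamma> \<Rrightarrow> \<Delta>)"
| rule_N: "rN \<in> X \<Longrightarrow> inference X [\<Gamma> \<Rrightarrow> \<Delta>] (Nablas \<Gamma> \<Rrightarrow> map_option Nabla \<Delta>)"
| rule_Fa: "rFa \<in> X \<Longrightarrow>
    inference X [add_mset A \<Gamma> \<Rrightarrow> Some B] (\<Gamma> \<Rrightarrow> Some (Nabla (Imp A B)))"
| rule_Fu: "rFu \<in> X \<Longrightarrow>
    inference X [Nablas \<Gamma> \<Rrightarrow> Some A, add_mset B (Nablas \<Gamma>) \<Rrightarrow> map_option Nabla \<Delta>]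
      (add_mset (Imp A B) \<Gamma> \<Rrightarrow> \<Delta>)"
| rule_H_left: "rH \<in> X \<Longrightarrow>
    inference X [\<Gamma> \<Rrightarrow> Some A, add_mset B \<Gamma> \<Rrightarrow> \<Delta>] (add_mset (HImp A B) \<Gamma> \<Rrightarrow> \<Delta>)"
| rule_H_right: "rH \<in> X \<Longrightarrow>
    inference X [add_mset A \<Gamma> \<Rrightarrow> Some B] (\<Gamma> \<Rrightarrow> Some (HImp A B))"

text \<open>\<open>STL X S s\<close>: the sequent \<open>s\<close> is derivable from the set \<open>S\<close> of sequents in the calculus
  \<open>STL\<close> extended by the rules in \<open>X\<close>, all inferences staying in the language of that calculus.\<close>

inductive STL :: "rule set \<Rightarrow> 'a sequent set \<Rightarrow> 'a sequent \<Rightarrow> bool" for X S where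
  hyp: "s \<in> S \<Longrightarrow> STL X S s"
| step: "inference X ps s \<Longrightarrow> s \<in> sequents X \<Longrightarrow> (\<forall>p\<in>set ps. STL X S p) \<Longrightarrow> STL X S s"

record 'w frame =
  Worlds :: "'w set"
  Le :: "'w rel"
  Acc :: "'w rel"

definition kripke_frame :: "'w frame \<Rightarrow> bool" where
  "kripke_frame F \<longleftrightarrow>
     partial_order_on (Worlds F) (Le F) \<and>
     Acc F \<subseteq> Worlds F \<times> Worlds F \<and>
     (\<forall>k' k l l'. (k', k) \<in> Le F \<longrightarrow> (k, l) \<in> Acc F \<longrightarrow> (l, l') \<in> Le F \<longrightarrow> (k', l') \<in> Acc F)"

definition frame_N :: "'w frame \<Rightarrow> bool" where
  "frame_N F \<longleftrightarrow>
     (\<exists>\<pi>. (\<forall>x\<in>Worlds F. \<pi> x \<in> Worlds F) \<and>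
          (\<forall>x y. (x, y) \<in> Le F \<longrightarrow> (\<pi> x, \<pi> y) \<in> Le F) \<and>
          (\<forall>x\<in>Worlds F. \<forall>y\<in>Worlds F. (x, y) \<in> Acc F \<longleftrightarrow> (x, \<pi> y) \<in> Le F))"

definition frame_R :: "'w frame \<Rightarrow> bool" where
  "frame_R F \<longleftrightarrow> Le F \<subseteq> Acc F"

definition frame_L :: "'w frame \<Rightarrow> bool" where
  "frame_L F \<longleftrightarrow> Acc F \<subseteq> Le F"

definition frame_Fa :: "'w frame \<Rightarrow> bool" where
  "frame_Fa F \<longleftrightarrow>
     (\<forall>x\<in>Worlds F. \<exists>y. (y, x) \<in> Acc F \<and> (\<forall>z. (y, z) \<in> Acc F \<longrightarrow> (x, z) \<in> Le F))"

definition frame_Fu :: "'w frame \<Rightarrow> bool" where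
  "frame_Fu F \<longleftrightarrow>
     (\<forall>x\<in>Worlds F. \<exists>y. (x, y) \<in> Acc F \<and> (\<forall>z. (z, y) \<in> Acc F \<longrightarrow> (z, x) \<in> Le F))"

definition K :: "rule set \<Rightarrow> 'w frame set" where
  "K C = {F. kripke_frame F \<and>
     (rN \<in> C \<longrightarrow> frame_N F) \<and> (rR \<in> C \<longrightarrow> frame_R F) \<and> (rL \<in> C \<longrightarrow> frame_L F) \<and>
     (rFa \<in> C \<longrightarrow> frame_Fa F) \<and> (rFu \<in> C \<longrightarrow> frame_Fu F)}"

definition valuation :: "'w frame \<Rightarrow> ('a \<Rightarrow> 'w set) \<Rightarrow> bool" where
  "valuation F V \<longleftrightarrow>
     (\<forall>p. V p \<subseteq> Worlds F \<and> (\<forall>x y. x \<in> V p \<longrightarrow> (x, y) \<in> Le F \<longrightarrow> y \<in> V p))"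

primrec forces :: "'w frame \<Rightarrow> ('a \<Rightarrow> 'w set) \<Rightarrow> 'w \<Rightarrow> 'a fm \<Rightarrow> bool" where
  "forces F V w (Atom p) \<longleftrightarrow> w \<in> V p"
| "forces F V w Top \<longleftrightarrow> True"
| "forces F V w Bot \<longleftrightarrow> False"
| "forces F V w (And A B) \<longleftrightarrow> forces F V w A \<and> forces F V w B"
| "forces F V w (Or A B) \<longleftrightarrow> forces F V w A \<or> forces F V w B"
| "forces F V w (Nabla A) \<longleftrightarrow> (\<exists>u. (u, w) \<in> Acc F \<and> forces F V u A)"
| "forces F V w (Imp A B) \<longleftrightarrow> (\<forall>u. (w, u) \<in> Acc F \<longrightarrow> forces F V u A \<longrightarrow> forces F V u B)"
| "forces F V w (HImp A B) \<longleftrightarrow> (\<forall>u. (w, u) \<in> Le F \<longrightarrow> forces F V u A \<longrightarrow> forces F V u B)"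

primrec validates :: "'w frame \<Rightarrow> ('a \<Rightarrow> 'w set) \<Rightarrow> 'a sequent \<Rightarrow> bool" where
  "validates F V (\<Gamma> \<Rrightarrow> \<Delta>) \<longleftrightarrow>
     (\<forall>w\<in>Worlds F. (\<forall>A\<in>#\<Gamma>. forces F V w A) \<longrightarrow> (\<exists>B\<in>set_option \<Delta>. forces F V w B))"

text \<open>
  Consequence over the frames in \<open>K C\<close> whose worlds are elements of the type \<open>'w\<close>. HOL cannot
  quantify over types inside a formula, so consequence over the class of all frames is rendered
  by soundness for every \<open>'w\<close> together with completeness for one sufficiently large type, that
  of sets of formulas, in which the prime theories of the calculus live.
\<close>

definition consequence :: "'w itself \<Rightarrow> rule set \<Rightarrow> 'a sequent set \<Rightarrow> 'a sequent \<Rightarrow> bool" where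
  "consequence (_ :: 'w itself) C S s \<longleftrightarrow>
     (\<forall>(F :: 'w frame) V. F \<in> K C \<longrightarrow> valuation F V \<longrightarrow>
        (\<forall>t\<in>S. validates F V t) \<longrightarrow> validates F V s)"

end

theory Submission
  imports Defs
begin

text \<open>
  Completeness is shown on the canonical model, whose worlds are the prime theories ordered by
  inclusion, with \<open>P\<close> related to \<open>Q\<close> when \<open>\<nabla>A \<in> Q\<close> for all \<open>A \<in> P\<close>. The modality is left adjoint
  to \<open>\<lambda>A. \<top> \<rightarrow> A\<close>, so it preserves finite joins and the formulas \<open>B\<close> with \<open>\<nabla>B \<notin> Q\<close> form an ideal;
  separating filters from ideals by prime theories then gives the truth lemma. The rules (Fa) and
  (Fu) amount to \<open>A \<Rightarrow> \<nabla>(\<top> \<rightarrow> A)\<close> and \<open>\<top> \<rightarrow> \<nabla>A \<Rightarrow> A\<close>, and the worlds demanded by the corresponding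
  frame conditions come from the same separation argument.
\<close>

section \<open>Soundness\<close>

text \<open>Persistence. Compatibility of \<open>Acc\<close> with \<open>Le\<close> lets a witness
  for \<open>Nabla\<close> survive an increase of the right endpoint, and lets the successors tested
  by \<open>Imp\<close> at \<open>y\<close> count as successors of \<open>x\<close>; reflexivity
  fills in the endpoint that stays fixed. For \<open>HImp\<close>, transitivity of \<open>Le\<close>
  suffices.\<close>

lemma forces_upward:
  assumes "kripke_frame F" "valuation F V" "(x, y) \<in> Le F" "forces F V x A"
  shows "forces F V y A"
  using assms(3,4)
proof (induction A arbitrary: x y)
  case (Atom p)
  then show ?case using assms(2) by (auto simp: valuation_def)
next
  case (Nabla A)
  then obtain u where u: "(u, x) \<in> Acc F" "forces F V u A" by auto
  moreover have "u \<in> Worlds F" using u(1) assms(1) by (auto simp: kripke_frame_def)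
  then have "(u, u) \<in> Le F"
    using assms(1) by (auto simp: kripke_frame_def partial_order_on_def preorder_on_def refl_on_def)
  ultimately have "(u, y) \<in> Acc F" using assms(1) Nabla.prems(1) unfolding kripke_frame_def by blast
  then show ?case using u(2) by auto
next
  case (Imp A B)
  have "(x, u) \<in> Acc F" if "(y, u) \<in> Acc F" for u
  proof -
    have "u \<in> Worlds F" using that assms(1) by (auto simp: kripke_frame_def)
    then have "(u, u) \<in> Le F"
      using assms(1) by (auto simp: kripke_frame_def partial_order_on_def preorder_on_def refl_on_def)
    then show ?thesis using assms(1) that Imp.prems(1) unfolding kripke_frame_def by blast
  qed
  then show ?case using Imp.prems(2) by auto
next
  case (HImp A B)
  have "trans (Le F)"
    using assms(1) by (auto simp: kripke_frame_def partial_order_on_def preorder_on_def)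
  then show ?case using HImp.prems by (auto dest: transD)
qed auto

text \<open>The inclusion on \<open>X\<close> guarantees that each modal rule comes with its frame
  condition, while (D) and (H) are sound on every frame. Premises are assumed valid in the whole
  model because several rules evaluate them at worlds other than the one under
  consideration.\<close>

lemma inference_sound:
  assumes "inference X ps s" and F: "F \<in> K C" and V: "valuation F V" and X: "X \<subseteq> C \<union> {rD, rH}"
    and ps: "\<forall>p\<in>set ps. validates F V p"
  shows "validates F V s"
proof -
  have kf: "kripke_frame F" using F by (simp add: K_def)
  have refl: "(w, w) \<in> Le F" if "w \<in> Worlds F" for w
    using kf that by (auto simp: kripke_frame_def partial_order_on_def preorder_on_def refl_on_def)
  have Le: "x \<in> Worlds F \<and> y \<in> Worlds F" if "(x, y) \<in> Le F" for x y
    using kf that by (auto simp: kripke_frame_def partial_order_on_def preorder_on_def)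
  have Acc: "x \<in> Worlds F \<and> y \<in> Worlds F" if "(x, y) \<in> Acc F" for x y
    using kf that by (auto simp: kripke_frame_def)
  note up = forces_upward[OF kf V]
  show ?thesis
    using assms(1) ps
  proof cases
    case (nabla A B)
    then show ?thesis using ps Acc by fastforce
  next
    case (imp_left \<Gamma> A B \<Delta>)
    \<comment> \<open>If \<open>u\<close> witnesses \<open>Nabla (Imp A B)\<close> at
      \<open>w\<close>, then \<open>w\<close> is itself a successor of \<open>u\<close>, so the
      implication applies at \<open>w\<close>.\<close>
    then show ?thesis using ps by fastforce
  next
    case (imp_right A \<Gamma> B)
    then show ?thesis using ps Acc by fastforce
  next
    case (rule_R \<Gamma> A)
    then have "frame_R F" using F X by (auto simp: K_def)
    then show ?thesis using rule_R ps refl unfolding frame_R_def by fastforce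
  next
    case (rule_L A \<Gamma> \<Delta>)
    then have "frame_L F" using F X by (auto simp: K_def)
    then have "(u, w) \<in> Acc F \<Longrightarrow> forces F V u A \<Longrightarrow> forces F V w A" for u w
      using up unfolding frame_L_def by blast
    then show ?thesis using rule_L ps by auto
  next
    case (rule_N \<Gamma> \<Delta>)
    then have "frame_N F" using F X by (auto simp: K_def)
    then obtain \<pi> where \<pi>: "\<And>x. x \<in> Worlds F \<Longrightarrow> \<pi> x \<in> Worlds F"
      "\<And>x y. x \<in> Worlds F \<Longrightarrow> y \<in> Worlds F \<Longrightarrow> (x, y) \<in> Acc F \<longleftrightarrow> (x, \<pi> y) \<in> Le F"
      unfolding frame_N_def by blast
    \<comment> \<open>The world \<open>\<pi> w\<close> is the greatest predecessor of
      \<open>w\<close>, so by persistence it decides \<open>Nabla A\<close> at \<open>w\<close>; all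
      formulas of a context can then be evaluated at this one world.\<close>
    have iff: "forces F V w (Nabla A) \<longleftrightarrow> forces F V (\<pi> w) A" if "w \<in> Worlds F" for w A
      unfolding forces.simps using \<pi>(1)[OF that] \<pi>(2)[OF _ that] refl up Acc by meson
    have prem: "validates F V (\<Gamma> \<Rrightarrow> \<Delta>)" using ps rule_N by auto
    show ?thesis
      unfolding rule_N validates.simps
    proof (intro ballI impI)
      fix w assume w: "w \<in> Worlds F" and "\<forall>A\<in>#Nablas \<Gamma>. forces F V w A"
      then have "\<forall>A\<in>#\<Gamma>. forces F V (\<pi> w) A" by (simp add: iff[OF w, symmetric])
      then obtain B where "B \<in> set_option \<Delta>" "forces F V (\<pi> w) B" using prem \<pi>(1)[OF w] by auto
      then show "\<exists>B\<in>set_option (map_option Nabla \<Delta>). forces F V w B"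
        using iff[OF w, of B] by (auto simp: option.set_map)
    qed
  next
    case (rule_Fa A \<Gamma> B)
    then have fa: "frame_Fa F" using F X by (auto simp: K_def)
    have prem: "validates F V (add_mset A \<Gamma> \<Rrightarrow> Some B)" using ps rule_Fa by auto
    show ?thesis
      unfolding rule_Fa validates.simps
    proof (intro ballI impI)
      fix x assume x: "x \<in> Worlds F" and \<Gamma>: "\<forall>A\<in>#\<Gamma>. forces F V x A"
      obtain y where y: "(y, x) \<in> Acc F" "\<And>z. (y, z) \<in> Acc F \<Longrightarrow> (x, z) \<in> Le F"
        using fa x unfolding frame_Fa_def by blast
      \<comment> \<open>Every successor of \<open>y\<close> lies above \<open>x\<close>, so the
        context persists to it and the premise applies there.\<close>
      have "forces F V z B" if "(y, z) \<in> Acc F" "forces F V z A" for z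
        using that prem y(2)[OF that(1)] \<Gamma> up Le by auto
      then show "\<exists>B\<in>set_option (Some (Nabla (Imp A B))). forces F V x B" using y(1) by auto
    qed
  next
    case (rule_Fu \<Gamma> A B \<Delta>)
    then have fu: "frame_Fu F" using F X by (auto simp: K_def)
    have prem: "validates F V (Nablas \<Gamma> \<Rrightarrow> Some A)"
      "validates F V (add_mset B (Nablas \<Gamma>) \<Rrightarrow> map_option Nabla \<Delta>)" using ps rule_Fu by auto
    show ?thesis
      unfolding rule_Fu validates.simps
    proof (intro ballI impI)
      fix x assume x: "x \<in> Worlds F" and \<Gamma>: "\<forall>A\<in>#add_mset (Imp A B) \<Gamma>. forces F V x A"
      obtain y where y: "(x, y) \<in> Acc F" "\<And>z. (z, y) \<in> Acc F \<Longrightarrow> (z, x) \<in> Le F"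
        using fu x unfolding frame_Fu_def by blast
      have yW: "y \<in> Worlds F" using Acc y(1) by blast
      \<comment> \<open>Going up, \<open>x\<close> is a predecessor of \<open>y\<close> and so
        witnesses \<open>Nablas \<Gamma>\<close> at \<open>y\<close>. Coming back, every predecessor
        of \<open>y\<close> lies below \<open>x\<close>, so a witness of \<open>Nabla D\<close> at
        \<open>y\<close> makes \<open>D\<close> true at \<open>x\<close> by persistence.\<close>
      have n: "\<forall>A\<in>#Nablas \<Gamma>. forces F V y A" using \<Gamma> y(1) by auto
      then have "forces F V y A" using prem(1) yW by auto
      then have "forces F V y B" using \<Gamma> y(1) by auto
      then obtain D where "D \<in> set_option \<Delta>" "forces F V y (Nabla D)"
        using prem(2) yW n by (fastforce simp: option.set_map)
      then show "\<exists>B\<in>set_option \<Delta>. forces F V x B" using y(2) up by auto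
    qed
  next
    case (rule_H_left \<Gamma> A B \<Delta>)
    then show ?thesis using ps refl by fastforce
  next
    case (rule_H_right A \<Gamma> B)
    then show ?thesis using ps up Le by fastforce
  qed (use ps in fastforce)+
qed

lemma STL_sound:
  assumes "STL X S s" and X: "X \<subseteq> C \<union> {rD, rH}"
  shows "consequence TYPE('w) C S s"
  unfolding consequence_def
proof (intro allI impI)
  fix F :: "'w frame" and V
  assume F: "F \<in> K C" "valuation F V" and S: "\<forall>t\<in>S. validates F V t"
  from assms(1) show "validates F V s"
  proof (induction rule: STL.induct)
    case (hyp s)
    then show ?case using S by blast
  next
    case (step ps s)
    then show ?case using inference_sound[OF step.hyps(1) F X] by blast
  qed
qed

section \<open>Derivability from a set of formulas\<close>

text \<open>The hypotheses \<open>S\<close> stay fixed, so theories and the canonical model are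
  built relative to them. The assumption \<open>dist\<close> provides disjunction elimination in the
  presence of side formulas.\<close>

locale calculus =
  fixes X :: "rule set" and S :: "'a sequent set"
  assumes S: "S \<subseteq> sequents X" and dist: "rD \<in> X \<or> rH \<in> X"
begin

abbreviation "Lang \<equiv> language X :: 'a fm set"

lemma Lang_simps [simp]:
  "Atom p \<in> Lang" "Top \<in> Lang" "Bot \<in> Lang"
  "And A B \<in> Lang \<longleftrightarrow> A \<in> Lang \<and> B \<in> Lang"
  "Or A B \<in> Lang \<longleftrightarrow> A \<in> Lang \<and> B \<in> Lang"
  "Nabla A \<in> Lang \<longleftrightarrow> A \<in> Lang"
  "Imp A B \<in> Lang \<longleftrightarrow> A \<in> Lang \<and> B \<in> Lang"
  by (auto simp: language_def)

lemma Lang_HImp: "HImp A B \<in> Lang \<Longrightarrow> rH \<in> X \<and> A \<in> Lang \<and> B \<in> Lang"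
  by (auto simp: language_def)

lemma Lang_if_rH: "rH \<in> X \<Longrightarrow> A \<in> Lang"
  by (auto simp: language_def)

section \<open>Structural rules\<close>

definition der :: "'a fm multiset \<Rightarrow> 'a fm option \<Rightarrow> bool" where
  "der \<Gamma> \<Delta> \<longleftrightarrow> STL X S (\<Gamma> \<Rrightarrow> \<Delta>)"

lemma der_Lang:
  assumes "der \<Gamma> \<Delta>"
  shows "set_mset \<Gamma> \<subseteq> Lang" "set_option \<Delta> \<subseteq> Lang"
proof -
  have "(\<Gamma> \<Rrightarrow> \<Delta>) \<in> sequents X"
    using assms S unfolding der_def by (cases rule: STL.cases) auto
  then show "set_mset \<Gamma> \<subseteq> Lang" "set_option \<Delta> \<subseteq> Lang" by (auto simp: sequents_def)
qed

lemma der_step: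
  assumes "inference X ps (\<Gamma> \<Rrightarrow> \<Delta>)" "set_mset \<Gamma> \<subseteq> Lang" "set_option \<Delta> \<subseteq> Lang"
    "\<forall>p\<in>set ps. STL X S p"
  shows "der \<Gamma> \<Delta>"
  using assms unfolding der_def by (intro STL.step[of _ ps]) (auto simp: sequents_def)

lemma der_weaken:
  "der \<Gamma> \<Delta> \<Longrightarrow> set_mset \<Gamma>' \<subseteq> Lang \<Longrightarrow> der (\<Gamma>' + \<Gamma>) \<Delta>"
proof (induction \<Gamma>')
  case (add A \<Gamma>')
  then have "der (\<Gamma>' + \<Gamma>) \<Delta>" by simp
  then show ?case
    using der_step[OF inference.weak_left[of _ "\<Gamma>' + \<Gamma>" \<Delta> A]] der_Lang[OF \<open>der (\<Gamma>' + \<Gamma>) \<Delta>\<close>] add.prems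
    by (simp add: der_def)
qed simp

lemma der_contract:
  "der (\<Gamma>' + \<Gamma>) \<Delta> \<Longrightarrow> set_mset \<Gamma>' \<subseteq> set_mset \<Gamma> \<Longrightarrow> der \<Gamma> \<Delta>"
proof (induction \<Gamma>')
  case (add A \<Gamma>')
  then have "A \<in># \<Gamma>" by simp
  then obtain \<Pi> where \<Pi>: "\<Gamma> = add_mset A \<Pi>" by (metis insert_DiffM)
  then have d: "der (add_mset A (add_mset A (\<Gamma>' + \<Pi>))) \<Delta>" using add.prems by simp
  have "der (add_mset A (\<Gamma>' + \<Pi>)) \<Delta>"
    using der_step[OF inference.contr[of _ A "\<Gamma>' + \<Pi>" \<Delta>]] der_Lang[OF d] d by (simp add: der_def)
  then show ?case using add \<Pi> by simp
qed simp

text \<open>Weakening and contraction make only the underlying set of a context matter, which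
  justifies passing from multisets to sets of formulas.\<close>

lemma der_mono:
  assumes "der \<Gamma> \<Delta>" "set_mset \<Gamma> \<subseteq> set_mset \<Gamma>'" "set_mset \<Gamma>' \<subseteq> Lang"
  shows "der \<Gamma>' \<Delta>"
  using der_contract[of \<Gamma> \<Gamma>' \<Delta>] der_weaken[of \<Gamma> \<Delta> \<Gamma>'] assms by (simp add: add.commute)

lemma der_cut:
  assumes "der \<Gamma> (Some A)" "der (add_mset A \<Pi>) \<Delta>"
  shows "der (\<Pi> + \<Gamma>) \<Delta>"
  using der_step[OF inference.cut[of _ \<Gamma> A \<Pi> \<Delta>]] der_Lang[OF assms(1)] der_Lang[OF assms(2)] assms
  by (simp add: der_def)

text \<open>This reduces empty right sides to \<open>Bot\<close>, so that entailment needs to speak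
  of single formulas only.\<close>

lemma der_None_iff_Bot: "der \<Gamma> None \<longleftrightarrow> der \<Gamma> (Some Bot)"
proof
  assume d: "der \<Gamma> None"
  then show "der \<Gamma> (Some Bot)"
    using der_step[OF inference.weak_right[of _ \<Gamma> Bot]] der_Lang[OF d] by (simp add: der_def)
next
  have "der {#Bot#} None" using der_step[OF inference.ax_bot] by simp
  then show "der \<Gamma> (Some Bot) \<Longrightarrow> der \<Gamma> None" using der_cut[of \<Gamma> Bot "{#}" None] by simp
qed

text \<open>The set \<open>T\<close> may be infinite, but a derivation uses finitely many of its
  members. Members outside the language contribute nothing, since derivable sequents stay inside
  it.\<close>

definition entails :: "'a fm set \<Rightarrow> 'a fm \<Rightarrow> bool" (infix \<open>\<tturnstile>\<close> 50) where
  "T \<tturnstile> A \<longleftrightarrow> (\<exists>\<Gamma>. set_mset \<Gamma> \<subseteq> T \<and> der \<Gamma> (Some A))"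

lemma entails_Lang: "T \<tturnstile> A \<Longrightarrow> A \<in> Lang"
  using der_Lang(2)[of _ "Some A"] by (auto simp: entails_def)

lemma entails_mono: "T \<tturnstile> A \<Longrightarrow> T \<subseteq> T' \<Longrightarrow> T' \<tturnstile> A"
  by (auto simp: entails_def)

lemma entails_assm: "A \<in> T \<Longrightarrow> A \<in> Lang \<Longrightarrow> T \<tturnstile> A"
  using der_step[OF inference.ax_id[of _ A]] unfolding entails_def
  by (intro exI[of _ "{#A#}"]) simp

text \<open>Logical rules act on one displayed occurrence of \<open>A\<close>: all copies of
  \<open>A\<close> are removed from the context and a single one is put back, by weakening if there
  was none.\<close>

lemma entails_insertE:
  assumes "insert A T \<tturnstile> B" "A \<in> Lang"
  obtains \<Gamma> where "set_mset \<Gamma> \<subseteq> T" "der (add_mset A \<Gamma>) (Some B)"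
proof -
  obtain \<Gamma> where \<Gamma>: "set_mset \<Gamma> \<subseteq> insert A T" "der \<Gamma> (Some B)" using assms(1) by (auto simp: entails_def)
  let ?\<Gamma> = "filter_mset (\<lambda>x. x \<noteq> A) \<Gamma>"
  have "der (add_mset A ?\<Gamma>) (Some B)"
    using \<Gamma>(2) der_Lang(1)[OF \<Gamma>(2)] assms(2) by (intro der_mono[OF \<Gamma>(2)]) auto
  then show thesis using \<Gamma>(1) by (intro that[of ?\<Gamma>]) auto
qed

lemma entails_pairE:
  assumes "T \<tturnstile> A" "T \<tturnstile> B"
  obtains \<Gamma> where "set_mset \<Gamma> \<subseteq> T" "der \<Gamma> (Some A)" "der \<Gamma> (Some B)"
proof -
  obtain \<Gamma> \<Gamma>' where \<Gamma>: "set_mset \<Gamma> \<subseteq> T" "der \<Gamma> (Some A)" "set_mset \<Gamma>' \<subseteq> T" "der \<Gamma>' (Some B)"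
    using assms by (auto simp: entails_def)
  have "der (\<Gamma> + \<Gamma>') (Some A)" "der (\<Gamma> + \<Gamma>') (Some B)"
    using der_mono[OF \<Gamma>(2)] der_mono[OF \<Gamma>(4)] der_Lang(1)[OF \<Gamma>(2)] der_Lang(1)[OF \<Gamma>(4)] by auto
  then show thesis using \<Gamma>(1,3) by (intro that[of "\<Gamma> + \<Gamma>'"]) auto
qed

lemma entails_cut:
  assumes "T \<tturnstile> A" "insert A T \<tturnstile> B"
  shows "T \<tturnstile> B"
proof -
  obtain \<Gamma> where \<Gamma>: "set_mset \<Gamma> \<subseteq> T" "der \<Gamma> (Some A)" using assms(1) by (auto simp: entails_def)
  obtain \<Pi> where \<Pi>: "set_mset \<Pi> \<subseteq> T" "der (add_mset A \<Pi>) (Some B)"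
    using entails_insertE[OF assms(2) entails_Lang[OF assms(1)]] .
  show ?thesis using der_cut[OF \<Gamma>(2) \<Pi>(2)] \<Gamma>(1) \<Pi>(1) by (auto simp: entails_def intro!: exI[of _ "\<Pi> + \<Gamma>"])
qed

text \<open>The finitely many premises actually used are cut one after the other, with
  \<open>T'\<close> as a side context throughout.\<close>

lemma entails_trans:
  assumes "T \<tturnstile> B" "\<And>A. A \<in> T \<Longrightarrow> A \<in> Lang \<Longrightarrow> T' \<tturnstile> A"
  shows "T' \<tturnstile> B"
proof -
  have "T' \<tturnstile> B" if "T' \<union> set_mset \<Gamma> \<tturnstile> B" "set_mset \<Gamma> \<subseteq> T" "set_mset \<Gamma> \<subseteq> Lang" for \<Gamma>
    using that
  proof (induction \<Gamma>)
    case (add A \<Gamma>)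
    then have "T' \<tturnstile> A" using assms(2) by simp
    then have "T' \<union> set_mset \<Gamma> \<tturnstile> B"
      using entails_cut[of "T' \<union> set_mset \<Gamma>" A B] entails_mono[of T' A "T' \<union> set_mset \<Gamma>"] add.prems(1)
      by simp
    then show ?case using add by simp
  qed simp
  moreover obtain \<Gamma> where "set_mset \<Gamma> \<subseteq> T" "der \<Gamma> (Some B)" using assms(1) by (auto simp: entails_def)
  moreover from this have "T' \<union> set_mset \<Gamma> \<tturnstile> B" by (auto simp: entails_def)
  ultimately show ?thesis using der_Lang(1) by blast
qed

section \<open>Propositional connectives\<close>

lemma entails_Top: "T \<tturnstile> Top"
  using der_step[OF inference.ax_top] unfolding entails_def by (intro exI[of _ "{#}"]) simp

lemma entails_Bot:
  assumes "T \<tturnstile> Bot" "A \<in> Lang"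
  shows "T \<tturnstile> A"
proof -
  obtain \<Gamma> where \<Gamma>: "set_mset \<Gamma> \<subseteq> T" "der \<Gamma> (Some Bot)" using assms(1) by (auto simp: entails_def)
  then have "der \<Gamma> None" by (simp add: der_None_iff_Bot)
  then have "der \<Gamma> (Some A)"
    using der_step[OF inference.weak_right[of _ \<Gamma> A]] der_Lang(1)[OF \<Gamma>(2)] assms(2) by (simp add: der_def)
  then show ?thesis using \<Gamma>(1) by (auto simp: entails_def)
qed

lemma entails_And_iff: "T \<tturnstile> And A B \<longleftrightarrow> T \<tturnstile> A \<and> T \<tturnstile> B"
proof (intro iffI conjI)
  assume "T \<tturnstile> A \<and> T \<tturnstile> B"
  then obtain \<Gamma> where \<Gamma>: "set_mset \<Gamma> \<subseteq> T" "der \<Gamma> (Some A)" "der \<Gamma> (Some B)"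
    using entails_pairE by blast
  have "der \<Gamma> (Some (And A B))"
    using der_step[OF inference.and_right[of _ \<Gamma> A B]] \<Gamma> der_Lang[OF \<Gamma>(2)] der_Lang[OF \<Gamma>(3)]
    by (simp add: der_def)
  then show "T \<tturnstile> And A B" using \<Gamma>(1) by (auto simp: entails_def)
next
  assume d: "T \<tturnstile> And A B"
  then have AB: "A \<in> Lang" "B \<in> Lang" using entails_Lang by fastforce+
  have "der {#A#} (Some A)" "der {#B#} (Some B)"
    using der_step[OF inference.ax_id[of _ A]] der_step[OF inference.ax_id[of _ B]] AB by simp_all
  then have "der {#And A B#} (Some A)" "der {#And A B#} (Some B)"
    using der_step[OF inference.and_left1[of _ A "{#}" "Some A" B]]
      der_step[OF inference.and_left2[of _ B "{#}" "Some B" A]] AB by (simp_all add: der_def)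
  then have "insert (And A B) T \<tturnstile> A" "insert (And A B) T \<tturnstile> B"
    unfolding entails_def by (auto intro!: exI[of _ "{#And A B#}"])
  then show "T \<tturnstile> A" "T \<tturnstile> B" using entails_cut[OF d] by auto
qed

lemma entails_OrI1:
  assumes "T \<tturnstile> A" "B \<in> Lang"
  shows "T \<tturnstile> Or A B"
proof -
  obtain \<Gamma> where \<Gamma>: "set_mset \<Gamma> \<subseteq> T" "der \<Gamma> (Some A)" using assms(1) by (auto simp: entails_def)
  then have "der \<Gamma> (Some (Or A B))"
    using der_step[OF inference.or_right1[of _ \<Gamma> A B]] der_Lang[OF \<Gamma>(2)] assms(2) by (simp add: der_def)
  then show ?thesis using \<Gamma>(1) by (auto simp: entails_def)
qed

lemma entails_OrI2:
  assumes "T \<tturnstile> B" "A \<in> Lang"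
  shows "T \<tturnstile> Or A B"
proof -
  obtain \<Gamma> where \<Gamma>: "set_mset \<Gamma> \<subseteq> T" "der \<Gamma> (Some B)" using assms(1) by (auto simp: entails_def)
  then have "der \<Gamma> (Some (Or A B))"
    using der_step[OF inference.or_right2[of _ \<Gamma> B A]] der_Lang[OF \<Gamma>(2)] assms(2) by (simp add: der_def)
  then show ?thesis using \<Gamma>(1) by (auto simp: entails_def)
qed

lemma entails_HImpI:
  assumes "rH \<in> X" "insert A T \<tturnstile> B"
  shows "T \<tturnstile> HImp A B"
proof -
  obtain \<Gamma> where \<Gamma>: "set_mset \<Gamma> \<subseteq> T" "der (add_mset A \<Gamma>) (Some B)"
    using entails_insertE[OF assms(2) Lang_if_rH[OF assms(1)]] .
  have "der \<Gamma> (Some (HImp A B))"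
    using der_step[OF inference.rule_H_right[OF assms(1), of A \<Gamma> B]] \<Gamma>(2) Lang_if_rH[OF assms(1)]
    by (auto simp: der_def)
  then show ?thesis using \<Gamma>(1) by (auto simp: entails_def)
qed

lemma entails_HImpE:
  assumes "rH \<in> X" "T \<tturnstile> HImp A B" "T \<tturnstile> A"
  shows "T \<tturnstile> B"
proof -
  obtain \<Gamma> where \<Gamma>: "set_mset \<Gamma> \<subseteq> T" "der \<Gamma> (Some A)" using assms(3) by (auto simp: entails_def)
  have L: "x \<in> Lang" for x using Lang_if_rH[OF assms(1)] .
  have "der {#B#} (Some B)" using der_step[OF inference.ax_id[of _ B]] L by simp
  then have "der (add_mset B \<Gamma>) (Some B)" by (rule der_mono) (auto simp: L)
  then have "der (add_mset (HImp A B) \<Gamma>) (Some B)"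
    using der_step[OF inference.rule_H_left[OF assms(1), of \<Gamma> A B "Some B"]] \<Gamma>(2) L
    by (auto simp: der_def)
  then have "insert (HImp A B) T \<tturnstile> B"
    using \<Gamma>(1) unfolding entails_def by (intro exI[of _ "add_mset (HImp A B) \<Gamma>"]) auto
  then show ?thesis using entails_cut[OF assms(2)] by blast
qed

text \<open>This is where \<open>dist\<close> enters. Rule (D) already has a context; otherwise (H)
  is present and residuation yields distributivity.\<close>

lemma entails_OrE:
  assumes "T \<tturnstile> Or A B" "insert A T \<tturnstile> D" "insert B T \<tturnstile> D"
  shows "T \<tturnstile> D"
proof -
  have AB: "A \<in> Lang" "B \<in> Lang" using entails_Lang[OF assms(1)] by auto
  have "insert (Or A B) T \<tturnstile> D"
  proof (cases "rD \<in> X")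
    case True
    obtain \<Gamma> where \<Gamma>: "set_mset \<Gamma> \<subseteq> T" "der (add_mset A \<Gamma>) (Some D)"
      using entails_insertE[OF assms(2) AB(1)] .
    obtain \<Gamma>' where \<Gamma>': "set_mset \<Gamma>' \<subseteq> T" "der (add_mset B \<Gamma>') (Some D)"
      using entails_insertE[OF assms(3) AB(2)] .
    have L: "set_mset (\<Gamma> + \<Gamma>') \<subseteq> Lang" "D \<in> Lang"
      using der_Lang[OF \<Gamma>(2)] der_Lang[OF \<Gamma>'(2)] by auto
    have "der (add_mset A (\<Gamma> + \<Gamma>')) (Some D)" "der (add_mset B (\<Gamma> + \<Gamma>')) (Some D)"
      using der_mono[OF \<Gamma>(2), of "add_mset A (\<Gamma> + \<Gamma>')"] der_mono[OF \<Gamma>'(2), of "add_mset B (\<Gamma> + \<Gamma>')"]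
        L AB by auto
    then have "der (add_mset (Or A B) (\<Gamma> + \<Gamma>')) (Some D)"
      using der_step[OF inference.rule_D[OF True, of A "\<Gamma> + \<Gamma>'" "Some D" B]] L AB by (auto simp: der_def)
    then show ?thesis using \<Gamma>(1) \<Gamma>'(1) unfolding entails_def
      by (intro exI[of _ "add_mset (Or A B) (\<Gamma> + \<Gamma>')"]) auto
  next
    case False
    then have H: "rH \<in> X" using dist by blast
    have L: "x \<in> Lang" for x using Lang_if_rH[OF H] .
    \<comment> \<open>The rule (\<open>\<or>\<close>L) allows no context, so the context is moved into nested implications.\<close>
    have "{Or A B} \<union> set_mset \<Gamma> \<tturnstile> D"
      if "insert A (set_mset \<Gamma>) \<tturnstile> D" "insert B (set_mset \<Gamma>) \<tturnstile> D" for \<Gamma> D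
      using that
    proof (induction \<Gamma> arbitrary: D)
      case empty
      obtain \<Gamma> where \<Gamma>: "set_mset \<Gamma> \<subseteq> {}" "der (add_mset A \<Gamma>) (Some D)"
        using entails_insertE[OF _ AB(1), of "{}" D] empty by auto
      obtain \<Gamma>' where \<Gamma>': "set_mset \<Gamma>' \<subseteq> {}" "der (add_mset B \<Gamma>') (Some D)"
        using entails_insertE[OF _ AB(2), of "{}" D] empty by auto
      have "der {#Or A B#} (Some D)"
        using der_step[OF inference.or_left[of _ A "Some D" B]] \<Gamma> \<Gamma>' AB L by (auto simp: der_def)
      then show ?case unfolding entails_def by (intro exI[of _ "{#Or A B#}"]) auto
    next
      case (add G \<Gamma>)
      have "{Or A B} \<union> set_mset \<Gamma> \<tturnstile> HImp G D"
        using add.prems by (intro add.IH entails_HImpI[OF H]) (simp_all add: insert_commute)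
      then have "{Or A B} \<union> set_mset (add_mset G \<Gamma>) \<tturnstile> HImp G D" by (rule entails_mono) auto
      then show ?case by (rule entails_HImpE[OF H]) (auto intro: entails_assm L)
    qed
    moreover obtain \<Gamma> where \<Gamma>: "set_mset \<Gamma> \<subseteq> T" "der (add_mset A \<Gamma>) (Some D)"
      using entails_insertE[OF assms(2) AB(1)] .
    moreover obtain \<Gamma>' where \<Gamma>': "set_mset \<Gamma>' \<subseteq> T" "der (add_mset B \<Gamma>') (Some D)"
      using entails_insertE[OF assms(3) AB(2)] .
    moreover have "insert A (set_mset (\<Gamma> + \<Gamma>')) \<tturnstile> D"
      unfolding entails_def using \<Gamma>(2) by (intro exI[of _ "add_mset A \<Gamma>"]) auto
    moreover have "insert B (set_mset (\<Gamma> + \<Gamma>')) \<tturnstile> D"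
      unfolding entails_def using \<Gamma>'(2) by (intro exI[of _ "add_mset B \<Gamma>'"]) auto
    ultimately have "{Or A B} \<union> set_mset (\<Gamma> + \<Gamma>') \<tturnstile> D" by blast
    then show ?thesis using \<Gamma>(1) \<Gamma>'(1) by (elim entails_mono) auto
  qed
  then show ?thesis using entails_cut[OF assms(1)] by blast
qed

section \<open>The modality and its implication\<close>

lemma entails_Nabla:
  assumes "{A} \<tturnstile> B" "A \<in> Lang"
  shows "{Nabla A} \<tturnstile> Nabla B"
proof -
  obtain \<Gamma> where "set_mset \<Gamma> \<subseteq> {}" "der (add_mset A \<Gamma>) (Some B)"
    using entails_insertE[OF assms] .
  then have d: "der {#A#} (Some B)" by simp
  then have "der {#Nabla A#} (Some (Nabla B))"
    using der_step[OF inference.nabla[of _ A B]] der_Lang[OF d] by (auto simp: der_def)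
  then show ?thesis unfolding entails_def by (intro exI[of _ "{#Nabla A#}"]) auto
qed

text \<open>The counit of the adjunction between the modality and the implication, obtained from the
  left rule by cut.\<close>

lemma entails_ImpE:
  assumes "T \<tturnstile> Nabla (Imp A B)" "T \<tturnstile> A"
  shows "T \<tturnstile> B"
proof -
  obtain \<Gamma> where \<Gamma>: "set_mset \<Gamma> \<subseteq> T" "der \<Gamma> (Some A)" using assms(2) by (auto simp: entails_def)
  have L: "A \<in> Lang" "B \<in> Lang" using entails_Lang[OF assms(1)] by auto
  have "der {#B#} (Some B)" using der_step[OF inference.ax_id[of _ B]] L by simp
  then have "der (add_mset B \<Gamma>) (Some B)" by (rule der_mono) (use L der_Lang[OF \<Gamma>(2)] in auto)
  then have "der (add_mset (Nabla (Imp A B)) \<Gamma>) (Some B)"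
    using der_step[OF inference.imp_left[of _ \<Gamma> A B "Some B"]] \<Gamma>(2) L der_Lang[OF \<Gamma>(2)]
    by (auto simp: der_def)
  then have "insert (Nabla (Imp A B)) T \<tturnstile> B"
    using \<Gamma>(1) unfolding entails_def by (intro exI[of _ "add_mset (Nabla (Imp A B)) \<Gamma>"]) auto
  then show ?thesis using entails_cut[OF assms(1)] by blast
qed

lemma Nablas_preimage:
  assumes "set_mset \<Gamma> \<subseteq> Nabla ` T"
  obtains \<Gamma>' where "set_mset \<Gamma>' \<subseteq> T" "\<Gamma> = Nablas \<Gamma>'"
  using assms
proof (induction \<Gamma> arbitrary: thesis)
  case (add A \<Gamma>)
  obtain \<Gamma>' where "set_mset \<Gamma>' \<subseteq> T" "\<Gamma> = Nablas \<Gamma>'" using add by auto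
  moreover obtain B where "B \<in> T" "A = Nabla B" using add by auto
  ultimately show ?case using add.prems(1)[of "add_mset B \<Gamma>'"] by simp
qed simp

text \<open>The other half of the adjunction. The context used may be any finite part of the image
  of \<open>T\<close>, so it is first rewritten as \<open>Nablas \<Gamma>\<close> to fit the right
  rule.\<close>

lemma entails_ImpI:
  assumes "insert A (Nabla ` T) \<tturnstile> B" "A \<in> Lang"
  shows "T \<tturnstile> Imp A B"
proof -
  obtain \<Gamma>0 where \<Gamma>0: "set_mset \<Gamma>0 \<subseteq> Nabla ` T" "der (add_mset A \<Gamma>0) (Some B)"
    using entails_insertE[OF assms] .
  obtain \<Gamma> where \<Gamma>: "set_mset \<Gamma> \<subseteq> T" "\<Gamma>0 = Nablas \<Gamma>" using Nablas_preimage[OF \<Gamma>0(1)] .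
  have "der \<Gamma> (Some (Imp A B))"
    using der_step[OF inference.imp_right[of _ A \<Gamma> B]] \<Gamma>0(2) \<Gamma>(2) der_Lang[OF \<Gamma>0(2)]
    by (simp add: der_def image_subset_iff subset_eq)
  then show ?thesis using \<Gamma>(1) by (auto simp: entails_def)
qed

text \<open>Transposition: apply the modality to the assumption, then compose with the counit, the
  antecedent \<open>Top\<close> being free.\<close>

lemma Nabla_adjoint:
  assumes "A \<in> Lang" "{A} \<tturnstile> Imp Top B"
  shows "{Nabla A} \<tturnstile> B"
  using entails_ImpE[OF entails_Nabla[OF assms(2,1)] entails_Top] .

text \<open>A left adjoint preserves the empty join.\<close>

lemma Nabla_Bot: "{Nabla Bot} \<tturnstile> Bot"
  by (rule Nabla_adjoint[OF _ entails_Bot[OF entails_assm]]) simp_all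

text \<open>A left adjoint preserves binary joins: after transposition the disjunction is no longer
  under the modality and can be split.\<close>

lemma Nabla_Or:
  assumes "A \<in> Lang" "B \<in> Lang"
  shows "{Nabla (Or A B)} \<tturnstile> Or (Nabla A) (Nabla B)"
proof (rule Nabla_adjoint)
  have "insert A {Or A B} \<tturnstile> Imp Top (Or (Nabla A) (Nabla B))"
    using assms by (intro entails_ImpI entails_OrI1) (auto intro: entails_assm)
  moreover have "insert B {Or A B} \<tturnstile> Imp Top (Or (Nabla A) (Nabla B))"
    using assms by (intro entails_ImpI entails_OrI2) (auto intro: entails_assm)
  moreover have "{Or A B} \<tturnstile> Or A B" using assms by (intro entails_assm) auto
  ultimately show "{Or A B} \<tturnstile> Imp Top (Or (Nabla A) (Nabla B))" by (rule entails_OrE[rotated])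
qed (use assms in auto)

section \<open>The additional rules as entailments\<close>

lemma entails_R:
  assumes "rR \<in> X" "T \<tturnstile> A"
  shows "T \<tturnstile> Nabla A"
proof -
  obtain \<Gamma> where \<Gamma>: "set_mset \<Gamma> \<subseteq> T" "der \<Gamma> (Some A)" using assms(2) by (auto simp: entails_def)
  then have "der \<Gamma> (Some (Nabla A))"
    using der_step[OF inference.rule_R[OF assms(1), of \<Gamma> A]] der_Lang[OF \<Gamma>(2)] by (simp add: der_def)
  then show ?thesis using \<Gamma>(1) by (auto simp: entails_def)
qed

lemma entails_L:
  assumes "rL \<in> X" "T \<tturnstile> Nabla A"
  shows "T \<tturnstile> A"
proof -
  have "A \<in> Lang" using entails_Lang[OF assms(2)] by simp
  then have "der {#Nabla A#} (Some A)"
    using der_step[OF inference.rule_L[OF assms(1), of A "{#}" "Some A"]]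
      der_step[OF inference.ax_id[of _ A]] by (simp add: der_def)
  then have "insert (Nabla A) T \<tturnstile> A"
    unfolding entails_def by (intro exI[of _ "{#Nabla A#}"]) auto
  then show ?thesis using entails_cut[OF assms(2)] by blast
qed

lemma entails_N:
  assumes "rN \<in> X" "T \<tturnstile> A"
  shows "Nabla ` T \<tturnstile> Nabla A"
proof -
  obtain \<Gamma> where \<Gamma>: "set_mset \<Gamma> \<subseteq> T" "der \<Gamma> (Some A)" using assms(2) by (auto simp: entails_def)
  then have "der (Nablas \<Gamma>) (Some (Nabla A))"
    using der_step[OF inference.rule_N[OF assms(1), of \<Gamma> "Some A"]] der_Lang[OF \<Gamma>(2)]
    by (simp add: der_def image_subset_iff subset_eq)
  then show ?thesis using \<Gamma>(1) unfolding entails_def by (intro exI[of _ "Nablas \<Gamma>"]) auto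
qed

lemma entails_Fa:
  assumes "rFa \<in> X" "A \<in> Lang"
  shows "{A} \<tturnstile> Nabla (Imp Top A)"
proof -
  have "der {#A#} (Some A)" using der_step[OF inference.ax_id[of _ A]] assms(2) by simp
  then have "der {#Top, A#} (Some A)" by (rule der_mono) (use assms(2) in auto)
  then have "der {#A#} (Some (Nabla (Imp Top A)))"
    using der_step[OF inference.rule_Fa[OF assms(1), of Top "{#A#}" A]] assms(2) by (simp add: der_def)
  then show ?thesis unfolding entails_def by (intro exI[of _ "{#A#}"]) auto
qed

text \<open>The instance of (Fu) with empty context, antecedent \<open>Top\<close> and consequent
  \<open>Nabla A\<close>, whose second premise is then an identity axiom.\<close>

lemma entails_Fu:
  assumes "rFu \<in> X" "A \<in> Lang"
  shows "{Imp Top (Nabla A)} \<tturnstile> A"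
proof -
  have "der {#Nabla A#} (Some (Nabla A))"
    using der_step[OF inference.ax_id[of _ "Nabla A"]] assms(2) by simp
  moreover have "der {#} (Some Top)" using der_step[OF inference.ax_top] by simp
  ultimately have "der {#Imp Top (Nabla A)#} (Some A)"
    using der_step[OF inference.rule_Fu[OF assms(1), of "{#}" Top "Nabla A" "Some A"]] assms(2)
    by (simp add: der_def)
  then show ?thesis unfolding entails_def by (intro exI[of _ "{#Imp Top (Nabla A)#}"]) auto
qed

section \<open>Prime theories\<close>

text \<open>Up to interderivability, these are the proper prime filters of the Lindenbaum algebra of
  the calculus with hypotheses \<open>S\<close>.\<close>

definition prime :: "'a fm set \<Rightarrow> bool" where
  "prime P \<longleftrightarrow> P \<subseteq> Lang \<and> (\<forall>A. P \<tturnstile> A \<longrightarrow> A \<in> P) \<and> Bot \<notin> P \<and>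
     (\<forall>A B. Or A B \<in> P \<longrightarrow> A \<in> P \<or> B \<in> P)"

lemma prime_entails_iff: "prime P \<Longrightarrow> P \<tturnstile> A \<longleftrightarrow> A \<in> P"
  using entails_assm by (auto simp: prime_def)

lemma prime_closed:
  assumes "prime P" "T \<subseteq> P" "T \<tturnstile> A"
  shows "A \<in> P"
  using prime_entails_iff[OF assms(1)] entails_mono[OF assms(3,2)] by blast

text \<open>The prime filter theorem. The set \<open>I\<close> is only directed upwards, a basis of
  an ideal rather than an ideal. A maximal set entailing nothing in \<open>I\<close> is prime,
  because two failing disjuncts would entail a common upper bound in \<open>I\<close>.\<close>

lemma prime_separation:
  assumes T: "T \<subseteq> Lang" and I: "I \<noteq> {}" "I \<subseteq> Lang"
    and dir: "\<And>A B. A \<in> I \<Longrightarrow> B \<in> I \<Longrightarrow> \<exists>E\<in>I. {A} \<tturnstile> E \<and> {B} \<tturnstile> E"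
    and disj: "\<And>A. A \<in> I \<Longrightarrow> \<not> T \<tturnstile> A"
  obtains P where "prime P" "T \<subseteq> P" "P \<inter> I = {}"
proof -
  let ?Z = "{P. T \<subseteq> P \<and> P \<subseteq> Lang \<and> (\<forall>A\<in>I. \<not> P \<tturnstile> A)}"
  have "\<exists>M\<in>?Z. \<forall>P\<in>?Z. M \<subseteq> P \<longrightarrow> P = M"
  proof (rule subset_Zorn_nonempty)
    show "?Z \<noteq> {}" using T disj by blast
    fix \<C> assume ne: "\<C> \<noteq> {}" and ch: "subset.chain ?Z \<C>"
    \<comment> \<open>An entailment from the union uses finitely many formulas, which already lie in
      one member of the chain.\<close>
    have "\<not> \<Union>\<C> \<tturnstile> A" if "A \<in> I" for A
    proof
      assume "\<Union>\<C> \<tturnstile> A"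
      then obtain \<Gamma> where \<Gamma>: "set_mset \<Gamma> \<subseteq> \<Union>\<C>" "der \<Gamma> (Some A)" by (auto simp: entails_def)
      obtain P where "P \<in> \<C>" "set_mset \<Gamma> \<subseteq> P"
        by (rule finite_subset_Union_chain[OF _ \<Gamma>(1) ne ch]) simp
      moreover from this have "P \<tturnstile> A" using \<Gamma>(2) by (auto simp: entails_def)
      ultimately show False using ch that by (auto simp: subset.chain_def)
    qed
    moreover have "T \<subseteq> \<Union>\<C>" "\<Union>\<C> \<subseteq> Lang" using ne ch by (force simp: subset.chain_def)+
    ultimately show "\<Union>\<C> \<in> ?Z" by simp
  qed
  then obtain P where P: "T \<subseteq> P" "P \<subseteq> Lang" "\<And>A. A \<in> I \<Longrightarrow> \<not> P \<tturnstile> A"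
    and max: "\<And>Q. T \<subseteq> Q \<Longrightarrow> Q \<subseteq> Lang \<Longrightarrow> (\<forall>A\<in>I. \<not> Q \<tturnstile> A) \<Longrightarrow> P \<subseteq> Q \<Longrightarrow> Q = P" by auto
  \<comment> \<open>By maximality, adding any new formula makes some member of \<open>I\<close>
    derivable.\<close>
  have ext: "\<exists>E\<in>I. insert A P \<tturnstile> E" if "A \<in> Lang" "A \<notin> P" for A
    using max[of "insert A P"] P(1,2) that by blast
  have closed: "A \<in> P" if "P \<tturnstile> A" for A
    using ext[of A] entails_Lang[OF that] entails_cut[OF that] P(3) by blast
  have "Bot \<notin> P"
  proof
    assume "Bot \<in> P"
    then have "P \<tturnstile> Bot" by (intro entails_assm) auto
    then show False using I P(3) entails_Bot by blast
  qed
  moreover have "A \<in> P \<or> B \<in> P" if AB: "Or A B \<in> P" for A B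
  proof (rule ccontr)
    assume "\<not> (A \<in> P \<or> B \<in> P)"
    moreover have "Or A B \<in> Lang" using AB P(2) by blast
    ultimately obtain E G where E: "E \<in> I" "insert A P \<tturnstile> E" and G: "G \<in> I" "insert B P \<tturnstile> G"
      using ext[of A] ext[of B] by auto
    obtain H where H: "H \<in> I" "{E} \<tturnstile> H" "{G} \<tturnstile> H" using dir E(1) G(1) by blast
    have "insert A P \<tturnstile> H" using entails_trans[OF H(2)] E(2) by blast
    moreover have "insert B P \<tturnstile> H" using entails_trans[OF H(3)] G(2) by blast
    ultimately have "P \<tturnstile> H"
      using entails_OrE[of P A B H] entails_assm[OF AB] \<open>Or A B \<in> Lang\<close> by blast
    then show False using P(3) H(1) by blast
  qed
  ultimately have "prime P" using P(2) closed by (auto simp: prime_def)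
  moreover have "P \<inter> I = {}" using P(2,3) entails_assm by blast
  ultimately show thesis using that P(1) by blast
qed

lemma prime_avoiding:
  assumes "T \<subseteq> Lang" "A \<in> Lang" "\<not> T \<tturnstile> A"
  obtains P where "prime P" "T \<subseteq> P" "A \<notin> P"
proof -
  have "{A} \<tturnstile> A" using assms(2) by (intro entails_assm) auto
  then obtain P where "prime P" "T \<subseteq> P" "P \<inter> {A} = {}"
    using prime_separation[of T "{A}"] assms by auto
  then show thesis using that by blast
qed

text \<open>Disjointness from the set of \<open>B\<close> with \<open>Nabla B\<close> outside
  \<open>Q\<close> says exactly that \<open>P\<close> precedes \<open>Q\<close>. Preservation of
  finite joins by the modality makes this set nonempty and directed.\<close>

lemma prime_predecessor:
  assumes Q: "prime Q" and T: "T \<subseteq> Lang" and "\<And>A. T \<tturnstile> A \<Longrightarrow> Nabla A \<in> Q"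
  obtains P where "prime P" "T \<subseteq> P" "Nabla ` P \<subseteq> Q"
proof -
  let ?I = "{B \<in> Lang. Nabla B \<notin> Q}"
  obtain P where P: "prime P" "T \<subseteq> P" "P \<inter> ?I = {}"
  proof (rule prime_separation[of T ?I])
    have "Nabla Bot \<notin> Q" using prime_closed[OF Q _ Nabla_Bot] Q by (auto simp: prime_def)
    then show "?I \<noteq> {}" using Lang_simps(3) by blast
    fix A B assume AB: "A \<in> ?I" "B \<in> ?I"
    then have "Nabla (Or A B) \<notin> Q"
      using prime_closed[OF Q _ Nabla_Or[of A B]] Q by (auto simp: prime_def)
    moreover have "{A} \<tturnstile> Or A B" "{B} \<tturnstile> Or A B"
      using AB by (simp_all add: entails_OrI1 entails_OrI2 entails_assm)
    ultimately show "\<exists>E\<in>?I. {A} \<tturnstile> E \<and> {B} \<tturnstile> E" using AB by (intro bexI[of _ "Or A B"]) auto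
  qed (use assms in auto)
  then have "Nabla ` P \<subseteq> Q" by (auto simp: prime_def)
  then show thesis using that P by blast
qed

section \<open>The canonical model\<close>

definition canon :: "'a fm set frame" where
  "canon = \<lparr>Worlds = Collect prime,
     Le = {(P, Q). prime P \<and> prime Q \<and> P \<subseteq> Q},
     Acc = {(P, Q). prime P \<and> prime Q \<and> Nabla ` P \<subseteq> Q}\<rparr>"

definition canon_val :: "'a \<Rightarrow> 'a fm set set" where
  "canon_val p = {P. prime P \<and> Atom p \<in> P}"

lemma canon_simps [simp]:
  "P \<in> Worlds canon \<longleftrightarrow> prime P"
  "(P, Q) \<in> Le canon \<longleftrightarrow> prime P \<and> prime Q \<and> P \<subseteq> Q"
  "(P, Q) \<in> Acc canon \<longleftrightarrow> prime P \<and> prime Q \<and> Nabla ` P \<subseteq> Q"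
  by (auto simp: canon_def)

lemma valuation_canon: "valuation canon canon_val"
  by (auto simp: valuation_def canon_val_def)

lemma kripke_frame_canon: "kripke_frame canon"
  unfolding kripke_frame_def
proof (intro conjI)
  show "partial_order_on (Worlds canon) (Le canon)"
    by (auto simp: partial_order_on_def preorder_on_def refl_on_def trans_def antisym_def)
qed auto

text \<open>The cases \<open>Nabla\<close>, \<open>Imp\<close> and \<open>HImp\<close> need prime
  theories as witnesses, found by separation. Restricting to \<open>Lang\<close> ensures that
  \<open>HImp\<close> is met only when (H) is available.\<close>

lemma truth:
  assumes "prime P" "A \<in> Lang"
  shows "forces canon canon_val P A \<longleftrightarrow> A \<in> P"
  using assms
proof (induction A arbitrary: P)
  case (Atom p)
  then show ?case by (simp add: canon_val_def)
next
  case Top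
  then show ?case using entails_Top prime_entails_iff by auto
next
  case Bot
  then show ?case by (simp add: prime_def)
next
  case (And A B)
  then show ?case using entails_And_iff[of P A B] by (simp add: prime_entails_iff)
next
  case (Or A B)
  have "Or A B \<in> P \<longleftrightarrow> A \<in> P \<or> B \<in> P"
    using entails_OrI1[of P A B] entails_OrI2[of P B A] Or.prems(2)
      prime_entails_iff[OF Or.prems(1)] Or.prems(1)[unfolded prime_def] by (metis Lang_simps(5))
  then show ?case using Or by simp
next
  case (Nabla A)
  have "\<exists>Q. prime Q \<and> Nabla ` Q \<subseteq> P \<and> A \<in> Q" if n: "Nabla A \<in> P"
  proof -
    \<comment> \<open>Monotonicity of the modality supplies the condition under which a predecessor
      containing \<open>A\<close> exists.\<close>
    have "Nabla B \<in> P" if "{A} \<tturnstile> B" for B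
      using prime_closed[OF Nabla.prems(1) _ entails_Nabla[OF that]] n Nabla.prems(2) by simp
    moreover have "{A} \<subseteq> Lang" using Nabla.prems(2) by simp
    ultimately obtain Q where "prime Q" "{A} \<subseteq> Q" "Nabla ` Q \<subseteq> P"
      using prime_predecessor[OF Nabla.prems(1), of "{A}"] by blast
    then show ?thesis by blast
  qed
  then show ?case using Nabla by auto
next
  case (Imp A B)
  have L: "A \<in> Lang" "B \<in> Lang" using Imp.prems by auto
  \<comment> \<open>Here \<open>Nabla (Imp A B)\<close> lies in \<open>Q\<close>, so the counit
    applies inside \<open>Q\<close>.\<close>
  have "B \<in> Q" if "Imp A B \<in> P" "prime Q" "Nabla ` P \<subseteq> Q" "A \<in> Q" for Q
    using entails_ImpE[of Q A B] that by (auto simp: prime_entails_iff)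
  moreover have "\<exists>Q. prime Q \<and> Nabla ` P \<subseteq> Q \<and> A \<in> Q \<and> B \<notin> Q" if "Imp A B \<notin> P"
  proof -
    have "\<not> insert A (Nabla ` P) \<tturnstile> B"
      using entails_ImpI[OF _ L(1)] that prime_entails_iff[OF Imp.prems(1)] by blast
    moreover have "insert A (Nabla ` P) \<subseteq> Lang" using L Imp.prems by (auto simp: prime_def)
    ultimately obtain Q where "prime Q" "insert A (Nabla ` P) \<subseteq> Q" "B \<notin> Q"
      using prime_avoiding[OF _ L(2)] by blast
    then show ?thesis by blast
  qed
  ultimately have "Imp A B \<in> P \<longleftrightarrow> (\<forall>Q. prime Q \<longrightarrow> Nabla ` P \<subseteq> Q \<longrightarrow> A \<in> Q \<longrightarrow> B \<in> Q)"
    by blast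
  then show ?case using Imp.IH(1)[OF _ L(1)] Imp.IH(2)[OF _ L(2)] Imp.prems(1) by auto
next
  case (HImp A B)
  have L: "rH \<in> X" "A \<in> Lang" "B \<in> Lang" using Lang_HImp[OF HImp.prems(2)] by auto
  have "B \<in> Q" if "HImp A B \<in> P" "prime Q" "P \<subseteq> Q" "A \<in> Q" for Q
    using entails_HImpE[OF L(1), of Q A B] that by (auto simp: prime_entails_iff)
  moreover have "\<exists>Q. prime Q \<and> P \<subseteq> Q \<and> A \<in> Q \<and> B \<notin> Q" if "HImp A B \<notin> P"
  proof -
    have "\<not> insert A P \<tturnstile> B"
      using entails_HImpI[OF L(1)] that prime_entails_iff[OF HImp.prems(1)] by blast
    moreover have "insert A P \<subseteq> Lang" using L HImp.prems by (auto simp: prime_def)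
    ultimately obtain Q where "prime Q" "insert A P \<subseteq> Q" "B \<notin> Q"
      using prime_avoiding[OF _ L(3)] by blast
    then show ?thesis by blast
  qed
  ultimately have "HImp A B \<in> P \<longleftrightarrow> (\<forall>Q. prime Q \<longrightarrow> P \<subseteq> Q \<longrightarrow> A \<in> Q \<longrightarrow> B \<in> Q)"
    by blast
  then show ?case using HImp.IH(1)[OF _ L(2)] HImp.IH(2)[OF _ L(3)] HImp.prems(1) by auto
qed

section \<open>Frame conditions of the canonical model\<close>

lemma frame_N_canon:
  assumes "rN \<in> X"
  shows "frame_N canon"
  unfolding frame_N_def
proof (intro exI[of _ "\<lambda>Q. {A. Nabla A \<in> Q}"] conjI)
  \<comment> \<open>Rule (N) handles several premises at once, so the preimage of \<open>Q\<close>
    under the modality is deductively closed. It is then the greatest predecessor of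
    \<open>Q\<close>.\<close>
  have pr: "prime {A. Nabla A \<in> Q}" if Q: "prime Q" for Q
    unfolding prime_def
  proof (intro conjI allI impI)
    show "{A. Nabla A \<in> Q} \<subseteq> Lang" using Q unfolding prime_def by (auto dest!: subsetD)
    show "A \<in> {A. Nabla A \<in> Q}" if "{A. Nabla A \<in> Q} \<tturnstile> A" for A
      using prime_closed[OF Q _ entails_N[OF assms that]] by auto
    show "Bot \<notin> {A. Nabla A \<in> Q}" using prime_closed[OF Q _ Nabla_Bot] Q by (auto simp: prime_def)
    show "A \<in> {A. Nabla A \<in> Q} \<or> B \<in> {A. Nabla A \<in> Q}" if "Or A B \<in> {A. Nabla A \<in> Q}" for A B
    proof -
      have "Nabla (Or A B) \<in> Lang" using that Q by (auto simp: prime_def)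
      then show ?thesis
        using prime_closed[OF Q _ Nabla_Or[of A B]] that Q by (auto simp: prime_def)
    qed
  qed
  then show "\<forall>x\<in>Worlds canon. {A. Nabla A \<in> x} \<in> Worlds canon"
    "\<forall>x y. (x, y) \<in> Le canon \<longrightarrow> ({A. Nabla A \<in> x}, {A. Nabla A \<in> y}) \<in> Le canon"
    "\<forall>x\<in>Worlds canon. \<forall>y\<in>Worlds canon. (x, y) \<in> Acc canon \<longleftrightarrow> (x, {A. Nabla A \<in> y}) \<in> Le canon"
    by auto
qed

lemma frame_R_canon:
  assumes "rR \<in> X"
  shows "frame_R canon"
proof -
  have "Nabla A \<in> Q" if "prime Q" "A \<in> Q" for A Q
    using that entails_R[OF assms, of Q A] by (simp add: prime_entails_iff)
  then show ?thesis unfolding frame_R_def by fastforce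
qed

lemma frame_L_canon:
  assumes "rL \<in> X"
  shows "frame_L canon"
proof -
  have "A \<in> Q" if "prime Q" "Nabla A \<in> Q" for A Q
    using that entails_L[OF assms, of Q A] by (simp add: prime_entails_iff)
  then show ?thesis by (auto simp: frame_L_def image_subset_iff)
qed

text \<open>In a set directed downwards, the finitely many premises of a derivation follow from a
  single member. This matters because monotonicity of the modality concerns one premise
  only.\<close>

lemma entails_directed:
  assumes "T \<tturnstile> B" "T \<noteq> {}" "T \<subseteq> Lang"
    and dir: "\<And>A B. A \<in> T \<Longrightarrow> B \<in> T \<Longrightarrow> \<exists>E\<in>T. {E} \<tturnstile> A \<and> {E} \<tturnstile> B"
  shows "\<exists>A\<in>T. {A} \<tturnstile> B"
proof -
  obtain \<Gamma> where \<Gamma>: "set_mset \<Gamma> \<subseteq> T" "der \<Gamma> (Some B)" using assms(1) by (auto simp: entails_def)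
  have "\<exists>E\<in>T. \<forall>A\<in>#\<Gamma>. {E} \<tturnstile> A"
    using \<Gamma>(1)
  proof (induction \<Gamma>)
    case empty
    then show ?case using assms(2) by auto
  next
    case (add A \<Gamma>)
    then obtain E where E: "E \<in> T" "\<forall>A\<in>#\<Gamma>. {E} \<tturnstile> A" by auto
    obtain G where G: "G \<in> T" "{G} \<tturnstile> A" "{G} \<tturnstile> E" using dir[of A E] add.prems E(1) by auto
    have "{G} \<tturnstile> D" if "D \<in># \<Gamma>" for D
      using entails_trans[of "{E}" D "{G}"] that E(2) G(3) by auto
    then show ?case using G by auto
  qed
  then obtain E where E: "E \<in> T" "\<forall>A\<in>#\<Gamma>. {E} \<tturnstile> A" by blast
  have "set_mset \<Gamma> \<tturnstile> B" using \<Gamma>(2) by (auto simp: entails_def)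
  then show ?thesis using entails_trans[of "set_mset \<Gamma>" B "{E}"] E by blast
qed

lemma frame_Fa_canon:
  assumes "rFa \<in> X"
  shows "frame_Fa canon"
  unfolding frame_Fa_def
proof
  fix P assume "P \<in> Worlds canon"
  then have P: "prime P" by simp
  \<comment> \<open>A predecessor containing \<open>Imp Top A\<close> forces \<open>A\<close> into
    each of its successors, by the counit; doing this for all \<open>A\<close> in \<open>P\<close>
    puts \<open>P\<close> below all successors.\<close>
  let ?T = "Imp Top ` P"
  have L: "P \<subseteq> Lang" using P by (simp add: prime_def)
  have "Nabla B \<in> P" if B: "?T \<tturnstile> B" for B
  proof -
    have "\<exists>A\<in>?T. {A} \<tturnstile> B"
    proof (rule entails_directed[OF B])
      show "?T \<noteq> {}" using entails_Top[of P] prime_entails_iff[OF P] by auto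
      fix A' B' assume "A' \<in> ?T" "B' \<in> ?T"
      then obtain A B where AB: "A \<in> P" "B \<in> P" "A' = Imp Top A" "B' = Imp Top B" by auto
      \<comment> \<open>Since \<open>Imp Top\<close> is monotone, the conjunction of two members of
        \<open>P\<close> gives a common lower bound in \<open>?T\<close>.\<close>
      have mono: "{Imp Top (And A B)} \<tturnstile> Imp Top D" if "\<And>T. T \<tturnstile> And A B \<Longrightarrow> T \<tturnstile> D" for D
        using AB L by (intro entails_ImpI that) (auto intro!: entails_ImpE[of _ Top "And A B", OF entails_assm entails_Top])
      have "And A B \<in> P" using AB P entails_And_iff[of P A B] by (simp add: prime_entails_iff)
      then show "\<exists>E\<in>?T. {E} \<tturnstile> A' \<and> {E} \<tturnstile> B'"
        using mono[of A] mono[of B] AB entails_And_iff by blast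
    qed (use L in auto)
    then obtain A where A: "A \<in> P" "{Imp Top A} \<tturnstile> B" by auto
    then have "{Nabla (Imp Top A)} \<tturnstile> Nabla B" using L by (intro entails_Nabla) auto
    moreover have "Nabla (Imp Top A) \<in> P"
      using prime_closed[OF P _ entails_Fa[OF assms, of A]] A(1) L by auto
    ultimately show ?thesis using prime_closed[OF P] by blast
  qed
  moreover have "?T \<subseteq> Lang" using L by auto
  ultimately obtain Q where Q: "prime Q" "?T \<subseteq> Q" "Nabla ` Q \<subseteq> P"
    using prime_predecessor[OF P, of ?T] by blast
  have "P \<subseteq> Z" if "prime Z" "Nabla ` Q \<subseteq> Z" for Z
  proof
    fix A assume "A \<in> P"
    then have "Nabla (Imp Top A) \<in> Z" using Q(2) that(2) by auto
    then show "A \<in> Z" using entails_ImpE[of Z Top A] entails_Top that(1) by (simp add: prime_entails_iff)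
  qed
  then show "\<exists>y. (y, P) \<in> Acc canon \<and> (\<forall>z. (y, z) \<in> Acc canon \<longrightarrow> (P, z) \<in> Le canon)"
    using P Q by (intro exI[of _ Q]) auto
qed

lemma frame_Fu_canon:
  assumes "rFu \<in> X"
  shows "frame_Fu canon"
  unfolding frame_Fu_def
proof
  fix P assume "P \<in> Worlds canon"
  then have P: "prime P" by simp
  then have L: "P \<subseteq> Lang" by (simp add: prime_def)
  \<comment> \<open>If \<open>Q\<close> omits \<open>Nabla A\<close> for every \<open>A\<close>
    outside \<open>P\<close>, then every predecessor of \<open>Q\<close> is contained in
    \<open>P\<close>. Primeness of \<open>P\<close> makes its complement closed under disjunction,
    hence \<open>?I\<close> directed.\<close>
  let ?I = "Nabla ` (Lang - P)"
  obtain Q where Q: "prime Q" "Nabla ` P \<subseteq> Q" "Q \<inter> ?I = {}"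
  proof (rule prime_separation[of "Nabla ` P" ?I])
    show "?I \<noteq> {}" using P Lang_simps(3) unfolding prime_def by blast
  next
    fix A' B' assume "A' \<in> ?I" "B' \<in> ?I"
    then obtain A B where AB: "A \<in> Lang - P" "B \<in> Lang - P" "A' = Nabla A" "B' = Nabla B" by auto
    have "{A} \<tturnstile> Or A B" "{B} \<tturnstile> Or A B"
      using AB by (simp_all add: entails_OrI1 entails_OrI2 entails_assm)
    then have "{A'} \<tturnstile> Nabla (Or A B)" "{B'} \<tturnstile> Nabla (Or A B)" using AB entails_Nabla by auto
    moreover have "Or A B \<in> Lang - P" using AB P by (auto simp: prime_def)
    ultimately show "\<exists>E\<in>?I. {A'} \<tturnstile> E \<and> {B'} \<tturnstile> E" by blast
  next
    fix A' assume "A' \<in> ?I"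
    then obtain A where A: "A \<in> Lang" "A \<notin> P" "A' = Nabla A" by auto
    show "\<not> Nabla ` P \<tturnstile> A'"
    proof
      assume "Nabla ` P \<tturnstile> A'"
      \<comment> \<open>By the adjunction the entailment moves to \<open>P\<close>, where (Fu) would
        give the excluded formula \<open>A\<close>.\<close>
      then have "P \<tturnstile> Imp Top (Nabla A)"
        using A by (intro entails_ImpI) (auto elim: entails_mono)
      then have "{Imp Top (Nabla A)} \<subseteq> P" using P by (simp add: prime_entails_iff)
      then show False using prime_closed[OF P _ entails_Fu[OF assms A(1)]] A(2) by blast
    qed
  qed (use L in auto)
  have "Z \<subseteq> P" if "prime Z" "Nabla ` Z \<subseteq> Q" for Z
    using that Q(3) by (auto simp: prime_def)
  then show "\<exists>y. (P, y) \<in> Acc canon \<and> (\<forall>z. (z, y) \<in> Acc canon \<longrightarrow> (z, P) \<in> Le canon)"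
    using P Q by (intro exI[of _ Q]) auto
qed

section \<open>Completeness\<close>

lemma validates_canon_iff:
  assumes "s \<in> sequents X"
  shows "validates canon canon_val s \<longleftrightarrow> STL X S s"
proof -
  obtain \<Gamma> \<Delta> where s: "s = (\<Gamma> \<Rrightarrow> \<Delta>)" "set_mset \<Gamma> \<subseteq> Lang" "set_option \<Delta> \<subseteq> Lang"
    using assms by (auto simp: sequents_def)
  \<comment> \<open>The choice \<open>Bot\<close> for an empty right side is faithful on both sides:
    no prime theory contains it, and deriving it is the same as deriving the empty right
    side.\<close>
  define D where "D = (case \<Delta> of None \<Rightarrow> Bot | Some D \<Rightarrow> D)"
  have D: "D \<in> Lang" using s(3) by (auto simp: D_def split: option.split)
  have "(\<exists>B\<in>set_option \<Delta>. forces canon canon_val P B) \<longleftrightarrow> D \<in> P" if "prime P" for P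
    using truth[OF that] that s(3) by (auto simp: D_def prime_def split: option.split)
  moreover have "(\<forall>A\<in>#\<Gamma>. forces canon canon_val P A) \<longleftrightarrow> set_mset \<Gamma> \<subseteq> P" if "prime P" for P
    using truth[OF that] s(2) by auto
  ultimately have "validates canon canon_val s \<longleftrightarrow> (\<forall>P. prime P \<longrightarrow> set_mset \<Gamma> \<subseteq> P \<longrightarrow> D \<in> P)"
    unfolding s(1) by auto
  also have "\<dots> \<longleftrightarrow> set_mset \<Gamma> \<tturnstile> D"
  proof
    show "\<forall>P. prime P \<longrightarrow> set_mset \<Gamma> \<subseteq> P \<longrightarrow> D \<in> P \<Longrightarrow> set_mset \<Gamma> \<tturnstile> D"
      using prime_avoiding[OF s(2) D] by metis
  qed (auto intro: prime_closed)
  also have "\<dots> \<longleftrightarrow> der \<Gamma> (Some D)"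
    using der_mono[OF _ _ s(2)] by (auto simp: entails_def)
  also have "\<dots> \<longleftrightarrow> STL X S s"
    using der_None_iff_Bot[of \<Gamma>] by (auto simp: D_def s(1) der_def split: option.split)
  finally show ?thesis .
qed

text \<open>The agreement of canonical validity with derivability is used twice: hypotheses in
  \<open>S\<close> are derivable and hence valid in the canonical model, and validity of
  \<open>s\<close> there turns back into a derivation.\<close>

lemma STL_complete:
  assumes "consequence TYPE('a fm set) C S s" "s \<in> sequents X" "C \<subseteq> X"
  shows "STL X S s"
proof -
  have "canon \<in> K C"
    using kripke_frame_canon frame_N_canon frame_R_canon frame_L_canon frame_Fa_canon frame_Fu_canon
      assms(3) by (auto simp: K_def)
  moreover have "\<forall>t\<in>S. validates canon canon_val t"
    using validates_canon_iff S STL.hyp by blast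
  ultimately show ?thesis
    using assms(1,2) valuation_canon validates_canon_iff unfolding consequence_def by blast
qed

end

theorem theorem6p10:
  fixes C :: "rule set" and S :: "'a sequent set" and s :: "'a sequent"
  assumes "C \<subseteq> {rN, rR, rL, rFa, rFu}"
  shows "(S \<subseteq> sequents (C \<union> {rD}) \<longrightarrow> s \<in> sequents (C \<union> {rD}) \<longrightarrow>
            (STL (C \<union> {rD}) S s \<longleftrightarrow> consequence TYPE('a fm set) C S s) \<and>
            (STL (C \<union> {rD}) S s \<longrightarrow> consequence TYPE('w) C S s)) \<and>
         (S \<subseteq> sequents (C \<union> {rH}) \<longrightarrow> s \<in> sequents (C \<union> {rH}) \<longrightarrow>
            (STL (C \<union> {rH}) S s \<longleftrightarrow> consequence TYPE('a fm set) C S s) \<and>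
            (STL (C \<union> {rH}) S s \<longrightarrow> consequence TYPE('w) C S s))"
proof -
  \<comment> \<open>Both calculi are treated uniformly through the extra rule \<open>d\<close>.
    Soundness is applied at two types of worlds: the arbitrary one and that of the canonical
    model.\<close>
  have "(STL (C \<union> {d}) S s \<longleftrightarrow> consequence TYPE('a fm set) C S s) \<and>
        (STL (C \<union> {d}) S s \<longrightarrow> consequence TYPE('w) C S s)"
    if d: "d = rD \<or> d = rH" and "S \<subseteq> sequents (C \<union> {d})" "s \<in> sequents (C \<union> {d})" for d
  proof -
    interpret calculus "C \<union> {d}" S using that by unfold_locales auto
    have "C \<union> {d} \<subseteq> C \<union> {rD, rH}" using d by auto
    then show ?thesis
      using STL_sound[of "C \<union> {d}" S s C, where 'w = 'w]
        STL_sound[of "C \<union> {d}" S s C, where 'w = "'a fm set"] STL_complete[of C s] that(3) by blast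
  qed
  then show ?thesis by blast
qed

end
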